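(* Let $N\ge d$, let $s:\mathbb{Z}/d\mathbb{Z}\to\mathbb{Z}/N\mathbb{Z}$ be injective with $\gcd(s(n),N)=1$ for every $n\in\mathbb{Z}/d\mathbb{Z}$, and let $\{x_k\}_{k=0}^{N-1}$ be the DFT frame for $\mathbb{C}^d$ defined by $s$, with modulation functions $e^j$. Let $q=i(e^1-e^{-1})$. Then, for every $u\in\ell^2(\mathbb{Z}/N\mathbb{Z}\times\mathbb{Z}/d\mathbb{Z})$, $$\left(\sum_{m=0}^{N-1}\operatorname{Im}\langle u(m),(q(m)+q(m+1))u(m+1)\rangle\right)^2+\left(\sum_{m=0}^{N-1}\operatorname{Re}\langle u(m),(q(m)-q(m+1))u(m+1)\rangle\right)^2\le\|(e^1-e^{-1})u\|^2\,\|(e^1-e^{-1})\widehat{u}\|^2,$$ where $\widehat{u}=\mathcal{F}u$ is the unitary vector-valued DFT of $u$.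
   Context: An element $u\in\ell^2(\mathbb{Z}/N\mathbb{Z}\times\mathbb{Z}/d\mathbb{Z})$ is regarded as a function $u:\mathbb{Z}/N\mathbb{Z}\to\mathbb{C}^d$, with $u(m)(p)\in\mathbb{C}$ the $p$-th coordinate of $u(m)$. Products of vectors in $\mathbb{C}^d$, and of $\mathbb{C}^d$-valued functions on $\mathbb{Z}/N\mathbb{Z}$, are coordinatewise. $\langle\cdot,\cdot\rangle$ is the standard inner product on $\mathbb{C}^d$ (linear in the first argument), and $\|u\|^2=\sum_{m}\sum_p|u(m)(p)|^2$. Indices $m$ are taken modulo $N$. The DFT frame defined by $s$ is $\{x_m\}_{m\in\mathbb{Z}/N\mathbb{Z}}\subseteq\mathbb{C}^d$ with coordinates $x_m(p)=e^{2\pi i m s(p)/N}$, $p\in\mathbb{Z}/d\mathbb{Z}$. For $j\in\mathbb{Z}/N\mathbb{Z}$, the modulation function $e^j:\mathbb{Z}/N\mathbb{Z}\to\mathbb{C}^d$ is $e^j(k)=x_{jk}$. The unitary vector-valued DFT is $(\mathcal{F}u)(n)=\frac{1}{\sqrt N}\sum_{m=0}^{N-1}u(m)x_{-mn}$. *)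

theory Defs
  imports "HOL-Analysis.Analysis" "HOL-Library.Periodic_Fun" "HOL-Number_Theory.Cong"
begin

text \<open>
  A function on \<open>\<int>/N\<int>\<close> is represented by an \<open>N\<close>-periodic function on \<^typ>\<open>int\<close>
  (predicate \<open>periodic_fun_simple\<close>), and a map into \<open>\<int>/N\<int>\<close> by integer representatives
  of its values.  The index set \<open>\<int>/d\<int>\<close> is a finite type \<open>'d\<close> with \<open>d = CARD('d)\<close>.
  On \<open>complex ^ 'd\<close> the operation \<open>*\<close> is the coordinatewise product and \<open>*s\<close> is
  multiplication by a complex scalar.
\<close>

text \<open>The library class \<open>real_inner\<close> provides only the real inner product on \<open>complex ^ 'd\<close>.\<close>

definition cinner :: "complex ^ 'd \<Rightarrow> complex ^ 'd \<Rightarrow> complex" where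
  "cinner v w = (\<Sum>p\<in>UNIV. v $ p * cnj (w $ p))"

definition l2norm :: "nat \<Rightarrow> (int \<Rightarrow> complex ^ 'd) \<Rightarrow> real" where
  "l2norm N u = sqrt (\<Sum>m\<in>{0..<int N}. \<Sum>p\<in>UNIV. (cmod (u m $ p))\<^sup>2)"

definition dft_frame :: "nat \<Rightarrow> ('d \<Rightarrow> int) \<Rightarrow> int \<Rightarrow> complex ^ 'd" where
  "dft_frame N s m = (\<chi> p. exp (2 * of_real pi * \<i> * of_int m * of_int (s p) / of_nat N))"

definition modulation :: "nat \<Rightarrow> ('d \<Rightarrow> int) \<Rightarrow> int \<Rightarrow> int \<Rightarrow> complex ^ 'd" where
  "modulation N s j k = dft_frame N s (j * k)"

definition vdft :: "nat \<Rightarrow> ('d \<Rightarrow> int) \<Rightarrow> (int \<Rightarrow> complex ^ 'd) \<Rightarrow> int \<Rightarrow> complex ^ 'd" where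
  "vdft N s u n =
     (1 / of_real (sqrt (of_nat N))) *s (\<Sum>m\<in>{0..<int N}. u m * dft_frame N s (- (m * n)))"

text \<open>The frame depends only on the residue classes modulo \<open>N\<close> of its arguments.\<close>

lemma dft_frame_cong:
  assumes "N > 0" and m: "[m = m'] (mod int N)" and s: "\<And>p. [s p = s' p] (mod int N)"
  shows "dft_frame N s m = dft_frame N s' m'"
proof -
  have "exp (2 * of_real pi * \<i> * of_int m * of_int (s p) / of_nat N)
      = exp (2 * of_real pi * \<i> * of_int m' * of_int (s' p) / of_nat N)" for p
  proof -
    have "[m * s p = m' * s' p] (mod int N)"
      using m s by (rule cong_mult)
    then obtain k where k: "m * s p = m' * s' p + int N * k"
      by (metis cong_iff_lin cong_sym)
    have "of_int m * of_int (s p) = (of_int (m * s p) :: complex)"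
      by simp
    also have "\<dots> = of_int m' * of_int (s' p) + of_nat N * of_int k"
      by (simp add: k)
    finally have e: "of_int m * of_int (s p)
        = (of_int m' * of_int (s' p) + of_nat N * of_int k :: complex)" .
    have "2 * of_real pi * \<i> * of_int m * of_int (s p) / of_nat N
        = 2 * of_real pi * \<i> * (of_int m * of_int (s p)) / of_nat N"
      by (simp add: mult.assoc)
    also have "\<dots> = 2 * of_real pi * \<i> * of_int m' * of_int (s' p) / of_nat N
        + of_int (2 * k) * (of_real pi * \<i>)"
      using \<open>N > 0\<close> by (simp add: e field_simps)
    finally show ?thesis
      unfolding exp_eq by (intro exI[of _ k]) (simp add: mult_ac)
  qed
  then show ?thesis
    by (simp add: dft_frame_def)
qed

end

theory Submission
  imports Defs
begin

text \<open>
  Let \<open>D\<close> be the difference operator \<open>(D u)(m) = u(m + 1) - u(m - 1)\<close>.  Translation becomes modulation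
  under the vector-valued DFT, so \<open>(e\<^sup>1 - e\<^sup>-\<^sup>1) \<F>u = \<F>(D u)\<close>; since every \<open>s p\<close> is a unit modulo
  \<open>N\<close>, each coordinate of \<open>\<F>\<close> is a DFT with permuted frequencies and \<open>\<F>\<close> is unitary.
  The right-hand side is therefore \<open>\<parallel>q u\<parallel>\<^sup>2 \<parallel>D u\<parallel>\<^sup>2\<close>.  The function \<open>q\<close> is real-valued, and after
  a cyclic shift the two sums on the left are the imaginary and the real part of
  \<open>\<langle>q u, D u\<rangle>\<close>, so that the claim is the Cauchy--Schwarz inequality.
\<close>

text \<open>With one integer argument, the frame, the modulations and the DFT kernel are all values
  of the same additive character, so identities between them become integer arithmetic in the
  exponent.\<close>

definition unity_char :: "nat \<Rightarrow> int \<Rightarrow> complex" where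
  "unity_char N k = cis (2 * pi * of_int k / of_nat N)"

lemma unity_char_add: "unity_char N (j + k) = unity_char N j * unity_char N k"
  by (simp add: unity_char_def cis_mult add_divide_distrib ring_distribs)

lemma unity_char_0 [simp]: "unity_char N 0 = 1"
  by (simp add: unity_char_def)

lemma unity_char_minus: "unity_char N (- k) = cnj (unity_char N k)"
  by (simp add: unity_char_def cis_cnj)

lemma unity_char_mult_nat: "unity_char N (k * int n) = unity_char N k ^ n"
  by (induction n) (simp_all add: unity_char_add algebra_simps)

lemma unity_char_eq_1_iff:
  assumes "N > 0"
  shows "unity_char N k = 1 \<longleftrightarrow> int N dvd k"
proof
  assume "unity_char N k = 1"
  then have "cos (2 * pi * of_int k / of_nat N) = 1"
    by (simp add: unity_char_def complex_eq_iff)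
  then obtain j :: int where "2 * pi * of_int k / of_nat N = of_int j * 2 * pi"
    unfolding cos_one_2pi_int by blast
  then have "real_of_int k = of_int (j * int N)"
    using assms by (simp add: field_simps)
  then have "k = j * int N"
    by (simp only: of_int_eq_iff)
  then show "int N dvd k"
    by simp
next
  assume "int N dvd k"
  then obtain j where "k = int N * j" ..
  then have "2 * pi * of_int k / of_nat N = 2 * pi * of_int j"
    using assms by simp
  then show "unity_char N k = 1"
    by (simp add: unity_char_def)
qed

text \<open>Orthogonality of characters: a geometric sum whose ratio is an \<open>N\<close>-th root
  of unity, equal to 1 exactly when \<open>N\<close> divides \<open>k\<close>.\<close>

lemma sum_unity_char:
  assumes "N > 0"
  shows "(\<Sum>n\<in>{0..<int N}. unity_char N (k * n)) = (if int N dvd k then of_nat N else 0)"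
proof -
  have "(\<Sum>n\<in>{0..<int N}. unity_char N (k * n)) = (\<Sum>n\<in>int ` {0..<N}. unity_char N (k * n))"
    by (simp add: image_int_atLeastLessThan)
  also have "\<dots> = (\<Sum>n<N. unity_char N k ^ n)"
    by (subst sum.reindex) (simp_all add: unity_char_mult_nat atLeast0LessThan)
  also have "\<dots> = (if int N dvd k then of_nat N else 0)"
  proof (cases "int N dvd k")
    case True
    then show ?thesis
      using unity_char_eq_1_iff[OF assms, of k] by simp
  next
    case False
    have "unity_char N k ^ N = 1"
      using unity_char_eq_1_iff[OF assms, of "k * int N"] by (simp add: unity_char_mult_nat)
    then show ?thesis
      using False unity_char_eq_1_iff[OF assms, of k] by (simp add: geometric_sum)
  qed
  finally show ?thesis .
qed

lemma dft_frame_nth: "dft_frame N s m $ p = unity_char N (m * s p)"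
  by (simp add: dft_frame_def unity_char_def cis_conv_exp mult_ac)

lemma modulation_nth: "modulation N s j k $ p = unity_char N (j * k * s p)"
  by (simp add: modulation_def dft_frame_nth)

lemma vdft_nth:
  "vdft N s u n $ p =
     (\<Sum>m\<in>{0..<int N}. u m $ p * unity_char N (- (m * n * s p))) / of_real (sqrt (of_nat N))"
  by (simp add: vdft_def dft_frame_nth)

text \<open>The difference of the two sums telescopes to \<open>g (int N) - g 0\<close>.\<close>

lemma sum_periodic_shift:
  fixes g :: "int \<Rightarrow> 'a::ab_group_add"
  assumes "g (int N) = g 0"
  shows "(\<Sum>m\<in>{0..<int N}. g (m + 1)) = (\<Sum>m\<in>{0..<int N}. g m)"
proof -
  have "(\<Sum>m\<in>{0..<int N}. g m) = (\<Sum>m<N. g (int m))" for g :: "int \<Rightarrow> 'a"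
  proof -
    have "(\<Sum>m\<in>{0..<int N}. g m) = (\<Sum>m\<in>int ` {0..<N}. g m)"
      by (simp add: image_int_atLeastLessThan)
    also have "\<dots> = (\<Sum>m<N. g (int m))"
      by (subst sum.reindex) (simp_all add: atLeast0LessThan)
    finally show ?thesis .
  qed
  moreover have "(\<Sum>m<N. g (int m + 1)) - (\<Sum>m<N. g (int m)) = g (int N) - g 0"
    using sum_lessThan_telescope[of "\<lambda>m. g (int m)" N]
    by (simp add: sum_subtractf add.commute)
  ultimately show ?thesis
    using assms by simp
qed

text \<open>Expanding the square gives character sums with frequency \<open>(l - m) * t\<close>. As
  \<open>t\<close> is a unit modulo \<open>N\<close>, only the diagonal \<open>l = m\<close>
  survives, with a factor \<open>N\<close> that the normalisation cancels.\<close>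

lemma parseval_unit_frequency:
  fixes f :: "int \<Rightarrow> complex"
  assumes "N > 0" and "coprime t (int N)"
  shows "(\<Sum>n\<in>{0..<int N}. (cmod ((\<Sum>m\<in>{0..<int N}. f m * unity_char N (- (m * n * t)))
            / of_real (sqrt (of_nat N))))\<^sup>2)
       = (\<Sum>m\<in>{0..<int N}. (cmod (f m))\<^sup>2)"
proof -
  let ?I = "{0..<int N}"
  let ?F = "\<lambda>n. \<Sum>m\<in>?I. f m * unity_char N (- (m * n * t))"
  have dvd: "int N dvd (l - m) * t \<longleftrightarrow> l = m" if "m \<in> ?I" "l \<in> ?I" for m l
  proof
    assume "int N dvd (l - m) * t"
    then have "int N dvd l - m"
      using assms(2) by (simp add: coprime_dvd_mult_left_iff coprime_commute)
    then have "l mod int N = m mod int N"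
      by (simp add: mod_eq_dvd_iff)
    then show "l = m"
      using that by simp
  qed simp
  have "(\<Sum>n\<in>?I. ?F n * cnj (?F n))
      = (\<Sum>n\<in>?I. \<Sum>m\<in>?I. \<Sum>l\<in>?I. f m * cnj (f l) * unity_char N ((l - m) * t * n))"
  proof (intro sum.cong refl)
    fix n
    have "unity_char N (- (m * n * t)) * cnj (unity_char N (- (l * n * t)))
        = unity_char N ((l - m) * t * n)" for m l
      by (simp flip: unity_char_minus unity_char_add add: algebra_simps)
    then have *: "f m * unity_char N (- (m * n * t)) * cnj (f l * unity_char N (- (l * n * t)))
        = f m * cnj (f l) * unity_char N ((l - m) * t * n)" for m l
      by (metis (no_types, lifting) complex_cnj_mult mult.assoc mult.left_commute)
    show "?F n * cnj (?F n)
        = (\<Sum>m\<in>?I. \<Sum>l\<in>?I. f m * cnj (f l) * unity_char N ((l - m) * t * n))"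
      by (simp only: * cnj_sum sum_product)
  qed
  \<comment> \<open>With the sum over \<open>n\<close> innermost, orthogonality applies for each
    pair \<open>m\<close>, \<open>l\<close>.\<close>
  also have "\<dots> = (\<Sum>m\<in>?I. \<Sum>l\<in>?I. \<Sum>n\<in>?I. f m * cnj (f l) * unity_char N ((l - m) * t * n))"
    by (subst sum.swap, rule sum.cong[OF refl], rule sum.swap)
  also have "\<dots> = (\<Sum>m\<in>?I. \<Sum>l\<in>?I. if m = l then f m * cnj (f l) * of_nat N else 0)"
    by (intro sum.cong refl)
      (auto simp: sum_unity_char[OF assms(1)] dvd simp flip: sum_distrib_left)
  also have "\<dots> = of_nat N * (\<Sum>m\<in>?I. f m * cnj (f m))"
    by (simp add: sum_distrib_left mult_ac)
  finally have "complex_of_real (\<Sum>n\<in>?I. (cmod (?F n))\<^sup>2)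
      = complex_of_real (of_nat N * (\<Sum>m\<in>?I. (cmod (f m))\<^sup>2))"
    by (simp only: of_real_sum of_real_mult of_real_of_nat_eq complex_norm_square)
  then have "(\<Sum>n\<in>?I. (cmod (?F n))\<^sup>2) = of_nat N * (\<Sum>m\<in>?I. (cmod (f m))\<^sup>2)"
    by (simp only: of_real_eq_iff)
  then show ?thesis
    using assms(1)
    by (simp add: norm_divide power_divide flip: sum_divide_distrib)
qed

lemma l2norm_square: "(l2norm N u)\<^sup>2 = (\<Sum>m\<in>{0..<int N}. \<Sum>p\<in>UNIV. (cmod (u m $ p))\<^sup>2)"
  by (simp add: l2norm_def sum_nonneg)

text \<open>Coordinate \<open>p\<close> is a scalar DFT whose frequency is multiplied by the unit
  \<open>s p\<close>, so Parseval applies to each coordinate separately.\<close>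

lemma l2norm_vdft:
  assumes "N > 0" and "\<And>p. coprime (s p) (int N)"
  shows "l2norm N (vdft N s u) = l2norm N u"
proof -
  have "(\<Sum>p\<in>UNIV. \<Sum>m\<in>{0..<int N}. (cmod (vdft N s u m $ p))\<^sup>2)
      = (\<Sum>p\<in>UNIV. \<Sum>m\<in>{0..<int N}. (cmod (u m $ p))\<^sup>2)"
    by (simp add: vdft_nth parseval_unit_frequency assms)
  then show ?thesis
    unfolding l2norm_def by (subst (1 2) sum.swap) simp
qed

text \<open>Reindexing moves the translation from \<open>u\<close> to the kernel, which is
  multiplicative. The factors \<open>?w (-1)\<close> and \<open>?w 1\<close> that come out are the
  coordinates of the modulations with index 1 and -1.\<close>

lemma vdft_difference:
  fixes u :: "int \<Rightarrow> complex ^ 'd"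
  assumes "N > 0" and "periodic_fun_simple u (int N)"
  shows "vdft N s (\<lambda>m. u (m + 1) - u (m - 1)) n
       = (modulation N s 1 n - modulation N s (-1) n) * vdft N s u n"
proof -
  interpret u: periodic_fun_simple u "int N" by fact
  have "vdft N s (\<lambda>m. u (m + 1) - u (m - 1)) n $ p
      = ((modulation N s 1 n - modulation N s (-1) n) * vdft N s u n) $ p" for p
  proof -
    let ?I = "{0..<int N}"
    let ?w = "\<lambda>m. unity_char N (- (m * n * s p))"
    have w: "?w (m + l) = ?w m * ?w l" for m l
      by (simp flip: unity_char_add add: algebra_simps)
    have wN: "?w (int N) = 1"
      using assms(1) by (subst unity_char_eq_1_iff) (simp_all add: mult.assoc)
    have inv: "?w 1 * ?w (-1) = 1"
      by (simp flip: unity_char_add)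
    have shift: "(\<Sum>m\<in>?I. u (m + 1) $ p * ?w (m + 1)) = (\<Sum>m\<in>?I. u m $ p * ?w m)"
      by (rule sum_periodic_shift) (use u.plus_1[of 0] wN in simp)
    \<comment> \<open>The endpoint values agree because \<open>u (int N - 1) = u (-1)\<close> and
      \<open>?w (int N) = ?w 0\<close>.\<close>
    have shift': "(\<Sum>m\<in>?I. u m $ p * ?w (m + 1)) = (\<Sum>m\<in>?I. u (m - 1) $ p * ?w m)"
      using sum_periodic_shift[of "\<lambda>m. u (m - 1) $ p * ?w m" N] u.plus_1[of "-1"] wN
      by simp
    have "(\<Sum>m\<in>?I. u (m + 1) $ p * ?w m) = ?w (-1) * (\<Sum>m\<in>?I. u (m + 1) $ p * ?w (m + 1))"
      using inv by (simp only: w sum_distrib_left) (intro sum.cong refl, algebra)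
    moreover have "(\<Sum>m\<in>?I. u (m - 1) $ p * ?w m) = ?w 1 * (\<Sum>m\<in>?I. u m $ p * ?w m)"
      unfolding shift'[symmetric] by (simp only: w sum_distrib_left) (simp only: mult_ac)
    ultimately have "(\<Sum>m\<in>?I. (u (m + 1) - u (m - 1)) $ p * ?w m)
        = (?w (-1) - ?w 1) * (\<Sum>m\<in>?I. u m $ p * ?w m)"
      unfolding shift by (simp only: vector_minus_component left_diff_distrib sum_subtractf)
    then show ?thesis
      by (simp only: vdft_nth modulation_nth vector_minus_component vector_mult_component) simp
  qed
  then show ?thesis
    by (simp add: vec_eq_iff)
qed

lemma Cauchy_Schwarz_complex_sum:
  fixes f g :: "'a \<Rightarrow> complex"
  shows "(cmod (\<Sum>i\<in>A. f i * cnj (g i)))\<^sup>2 \<le> (\<Sum>i\<in>A. (cmod (f i))\<^sup>2) * (\<Sum>i\<in>A. (cmod (g i))\<^sup>2)"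
proof -
  have "cmod (\<Sum>i\<in>A. f i * cnj (g i)) \<le> (\<Sum>i\<in>A. \<bar>cmod (f i)\<bar> * \<bar>cmod (g i)\<bar>)"
    by (rule order_trans[OF norm_sum]) (simp add: norm_mult)
  also have "\<dots> \<le> L2_set (\<lambda>i. cmod (f i)) A * L2_set (\<lambda>i. cmod (g i)) A"
    by (rule L2_set_mult_ineq)
  finally have "(cmod (\<Sum>i\<in>A. f i * cnj (g i)))\<^sup>2
      \<le> (L2_set (\<lambda>i. cmod (f i)) A * L2_set (\<lambda>i. cmod (g i)) A)\<^sup>2"
    by (rule power_mono) simp
  then show ?thesis
    by (simp add: L2_set_def power_mult_distrib sum_nonneg)
qed

lemma Cauchy_Schwarz_l2norm:
  "(cmod (\<Sum>m\<in>{0..<int N}. cinner (u m) (v m)))\<^sup>2 \<le> (l2norm N u)\<^sup>2 * (l2norm N v)\<^sup>2"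
  \<comment> \<open>The sums over \<open>m\<close> and \<open>p\<close> are merged into one sum over
    pairs.\<close>
  using Cauchy_Schwarz_complex_sum[of "\<lambda>(m, p). u m $ p" "\<lambda>(m, p). v m $ p" "{0..<int N} \<times> UNIV"]
  by (simp add: cinner_def l2norm_square sum.cartesian_product case_prod_unfold)

lemma cinner_diff_right: "cinner v (w - w') = cinner v w - cinner v w'"
  by (simp add: cinner_def right_diff_distrib sum_subtractf)

text \<open>Multiplication by a real vector is self-adjoint.\<close>

lemma cinner_real_multiplier:
  assumes "\<And>p. Im (a $ p) = 0"
  shows "cinner (a * v) w = cinner v (a * w)"
proof -
  have "cnj (a $ p) = a $ p" for p
    using assms by (simp add: complex_eq_iff)
  then show ?thesis
    by (simp add: cinner_def mult_ac)
qed

lemma cinner_cnj: "cinner v w = cnj (cinner w v)"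
  by (simp add: cinner_def mult.commute)

text \<open>A cyclic shift turns the \<open>u (m - 1)\<close> terms into conjugates of the terms
  \<open>?c m\<close>, leaving the sum of \<open>?b m - cnj (?c m)\<close>.\<close>

lemma cinner_multiplier_difference:
  fixes u a :: "int \<Rightarrow> complex ^ 'd"
  assumes "periodic_fun_simple u (int N)" and "a (int N) = a 0"
    and real: "\<And>m p. Im (a m $ p) = 0"
  shows "(\<Sum>m\<in>{0..<int N}. cinner (a m * u m) (u (m + 1) - u (m - 1)))
       = Complex (\<Sum>m\<in>{0..<int N}. Re (cinner (u m) ((a m - a (m + 1)) * u (m + 1))))
                 (\<Sum>m\<in>{0..<int N}. Im (cinner (u m) ((a m + a (m + 1)) * u (m + 1))))"
proof -
  interpret u: periodic_fun_simple u "int N" by fact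
  let ?I = "{0..<int N}"
  let ?b = "\<lambda>m. cinner (u m) (a m * u (m + 1))"
  let ?c = "\<lambda>m. cinner (u m) (a (m + 1) * u (m + 1))"
  have "(\<Sum>m\<in>?I. cinner (a m * u m) (u (m - 1)))
      = (\<Sum>m\<in>?I. cinner (a (m + 1) * u (m + 1)) (u m))"
    using sum_periodic_shift[of "\<lambda>m. cinner (a m * u m) (u (m - 1))" N]
      u.plus_1[of 0] u.plus_1[of "-1"] assms(2) by simp
  also have "\<dots> = (\<Sum>m\<in>?I. cnj (?c m))"
    by (simp flip: cinner_cnj)
  finally have "(\<Sum>m\<in>?I. cinner (a m * u m) (u (m + 1) - u (m - 1)))
      = (\<Sum>m\<in>?I. ?b m - cnj (?c m))"
    by (simp add: cinner_diff_right sum_subtractf cinner_real_multiplier[OF real])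
  \<comment> \<open>Conjugation changes the sign of the imaginary part only:
    \<open>?b m - cnj (?c m)\<close> has the real part of \<open>?b m - ?c m\<close> and the
    imaginary part of \<open>?b m + ?c m\<close>.\<close>
  moreover have "cinner (u m) ((a m - a (m + 1)) * u (m + 1)) = ?b m - ?c m"
    and "cinner (u m) ((a m + a (m + 1)) * u (m + 1)) = ?b m + ?c m" for m
    by (simp_all add: cinner_def algebra_simps sum_subtractf sum.distrib)
  ultimately show ?thesis
    by (simp add: complex_eq_iff)
qed

theorem theorem8p7:
  fixes N :: nat and s :: "'d::finite \<Rightarrow> int" and u :: "int \<Rightarrow> complex ^ 'd"
    and q :: "int \<Rightarrow> complex ^ 'd"
  assumes "CARD('d) \<le> N"
    and "inj (\<lambda>p. s p mod int N)"
    and "\<And>p. gcd (s p) (int N) = 1"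
    and "q = (\<lambda>m. \<i> *s (modulation N s 1 m - modulation N s (-1) m))"
    and "periodic_fun_simple u (int N)"
  shows "(\<Sum>m\<in>{0..<int N}. Im (cinner (u m) ((q m + q (m + 1)) * u (m + 1))))\<^sup>2
       + (\<Sum>m\<in>{0..<int N}. Re (cinner (u m) ((q m - q (m + 1)) * u (m + 1))))\<^sup>2
       \<le> (l2norm N (\<lambda>m. (modulation N s 1 m - modulation N s (-1) m) * u m))\<^sup>2
         * (l2norm N (\<lambda>n. (modulation N s 1 n - modulation N s (-1) n) * vdft N s u n))\<^sup>2"
proof -
  let ?D = "\<lambda>m. u (m + 1) - u (m - 1)"
  have "N > 0"
    using assms(1) zero_less_card_finite[where 'a = 'd] by linarith
  \<comment> \<open>The two modulations are conjugate, so their difference is purely imaginary and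
    the factor \<open>\<i>\<close> makes it real.\<close>
  have real: "Im (q m $ p) = 0" for m p
    by (simp add: assms(4) modulation_nth unity_char_minus)
  have "unity_char N (int N * k) = 1" "unity_char N (- (int N * k)) = 1" for k
    using \<open>N > 0\<close> by (simp_all add: unity_char_eq_1_iff)
  then have "q (int N) = q 0"
    by (simp add: assms(4) vec_eq_iff modulation_nth)
  note A = cinner_multiplier_difference[of u N q, OF assms(5) this real]
  have "l2norm N (\<lambda>m. q m * u m)
      = l2norm N (\<lambda>m. (modulation N s 1 m - modulation N s (-1) m) * u m)"
    by (simp add: l2norm_def assms(4) norm_mult flip: right_diff_distrib)
  \<comment> \<open>The right-hand side is the norm of the DFT of \<open>?D\<close>, and the DFT
    preserves norms.\<close>
  moreover have "l2norm N ?D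
      = l2norm N (\<lambda>n. (modulation N s 1 n - modulation N s (-1) n) * vdft N s u n)"
    using \<open>N > 0\<close> assms(3)
    by (simp add: l2norm_vdft coprime_iff_gcd_eq_1 flip: vdft_difference[OF _ assms(5)])
  ultimately show ?thesis
    \<comment> \<open>By \<open>A\<close>, the squared modulus of the pairing is the sum of the two
      squares on the left.\<close>
    using Cauchy_Schwarz_l2norm[where N = N and u = "\<lambda>m. q m * u m" and v = ?D]
    unfolding A by (simp add: cmod_power2 add.commute)
qed

end
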